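(* Let $L:\mathbb{R}^d\to\mathbb{R}$, $\theta^\star\in\mathbb{R}^d$ and checkpoints $\theta_1,\dots,\theta_K\in\mathbb{R}^d$ ($K\ge 2$) satisfy the flat-basin assumption stated in the context, and let $H=\nabla^2L(\theta^\star)\succeq 0$. Put $\delta_i=\theta_i-\theta^\star$, $\bar\theta=\frac1K\sum_{i=1}^K\theta_i$, and $$L_Q(\theta)=L(\theta^\star)+\tfrac12(\theta-\theta^\star)^\top H(\theta-\theta^\star).$$ Then $$L_Q(\bar\theta)\le\frac1K\sum_{i=1}^K L_Q(\theta_i),$$ with equality if and only if $\delta_i-\delta_j\in\ker(H)$ for all $i,j$ (in particular, when $H\succ0$, equality holds if and only if $\theta_1=\cdots=\theta_K$). The inequality is strict whenever for some pair $(i,j)$ the vector $\delta_i-\delta_j$ has non-zero orthogonal projection onto $\mathrm{range}(H)$. Moreover, $$\frac1K\sum_{i=1}^K L_Q(\theta_i)-L_Q(\bar\theta)=\frac{1}{4K^2}\sum_{i=1}^K\sum_{j=1}^K(\delta_i-\delta_j)^\top H(\delta_i-\delta_j)\ \ge 0.$$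
   Context: Flat-basin assumption: $\nabla L(\theta^\star)=0$, and there is a convex neighborhood $\mathcal{B}$ of $\theta^\star$, on which $L$ is twice differentiable, such that (a) $\theta_i\in\mathcal{B}$ for all $i$ and $\bar\theta\in\mathcal{B}$; (b) $0\preceq\nabla^2L(\theta)\preceq\lambda_{\max}I_d$ for all $\theta\in\mathcal{B}$, for some $\lambda_{\max}>0$; (c) on $\mathcal{B}$, $L(\theta)=L(\theta^\star)+\tfrac12(\theta-\theta^\star)^\top H(\theta-\theta^\star)+R(\theta)$ with $|R(\theta)|\le\frac{\rho}{6}\|\theta-\theta^\star\|^3$ for some constant $\rho>0$. Here $\succeq$ is the positive semidefinite order on symmetric matrices. *)

theory Defs
  imports "HOL-Analysis.Analysis"
begin

text \<open>
  Derivatives are taken within a set \<open>S\<close>, so that a neighbourhood containing some of its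
  boundary points is allowed. On a convex set with nonempty interior they are unique, and at
  interior points they are the ordinary ones; \<open>S = UNIV\<close> gives the ordinary gradient and Hessian.
  Both are meaningful only under differentiability, because \<^const>\<open>frechet_derivative\<close> is an
  arbitrary choice otherwise.
\<close>

definition gradient_within :: "(real ^ 'n \<Rightarrow> real) \<Rightarrow> (real ^ 'n) set \<Rightarrow> real ^ 'n \<Rightarrow> real ^ 'n"
  where "gradient_within f S x = (\<chi> i. frechet_derivative f (at x within S) (axis i 1))"

definition hessian_within :: "(real ^ 'n \<Rightarrow> real) \<Rightarrow> (real ^ 'n) set \<Rightarrow> real ^ 'n \<Rightarrow> real ^ 'n ^ 'n"
  where "hessian_within f S x = jacobian (gradient_within f S) (at x within S)"

abbreviation gradient :: "(real ^ 'n \<Rightarrow> real) \<Rightarrow> real ^ 'n \<Rightarrow> real ^ 'n"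
  where "gradient f \<equiv> gradient_within f UNIV"

abbreviation hessian :: "(real ^ 'n \<Rightarrow> real) \<Rightarrow> real ^ 'n \<Rightarrow> real ^ 'n ^ 'n"
  where "hessian f \<equiv> hessian_within f UNIV"

definition twice_differentiable_on :: "(real ^ 'n \<Rightarrow> real) \<Rightarrow> (real ^ 'n) set \<Rightarrow> bool"
  where "twice_differentiable_on f S \<longleftrightarrow>
    f differentiable_on S \<and> gradient_within f S differentiable_on S"

definition symmetric_matrix :: "real ^ 'n ^ 'n \<Rightarrow> bool"
  where "symmetric_matrix A \<longleftrightarrow> transpose A = A"

definition psd_le :: "real ^ 'n ^ 'n \<Rightarrow> real ^ 'n ^ 'n \<Rightarrow> bool"
  where "psd_le A B \<longleftrightarrow> symmetric_matrix A \<and> symmetric_matrix B \<and>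
    (\<forall>x. 0 \<le> x \<bullet> ((B - A) *v x))"

definition positive_definite :: "real ^ 'n ^ 'n \<Rightarrow> bool"
  where "positive_definite A \<longleftrightarrow> symmetric_matrix A \<and> (\<forall>x. x \<noteq> 0 \<longrightarrow> 0 < x \<bullet> (A *v x))"

definition matrix_kernel :: "real ^ 'n ^ 'm \<Rightarrow> (real ^ 'n) set"
  where "matrix_kernel A = {x. A *v x = 0}"

definition matrix_range :: "real ^ 'n ^ 'm \<Rightarrow> (real ^ 'm) set"
  where "matrix_range A = range (\<lambda>x. A *v x)"

definition orthogonal_projection :: "'a::euclidean_space set \<Rightarrow> 'a \<Rightarrow> 'a"
  where "orthogonal_projection S v = (THE p. p \<in> S \<and> (\<forall>w\<in>S. orthogonal (v - p) w))"

definition checkpoint_mean :: "nat \<Rightarrow> (nat \<Rightarrow> real ^ 'n) \<Rightarrow> real ^ 'n"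
  where "checkpoint_mean K \<theta> = (1 / real K) *\<^sub>R (\<Sum>i=1..K. \<theta> i)"

definition quadratic_model :: "(real ^ 'n \<Rightarrow> real) \<Rightarrow> real ^ 'n \<Rightarrow> real ^ 'n \<Rightarrow> real"
  where "quadratic_model L \<theta>s \<theta> = L \<theta>s + 1 / 2 * ((\<theta> - \<theta>s) \<bullet> (hessian L \<theta>s *v (\<theta> - \<theta>s)))"

text \<open>
  In the last conjunct the remainder is \<open>R \<theta> = L \<theta> - quadratic_model L \<theta>s \<theta>\<close>.
\<close>

definition flat_basin ::
    "(real ^ 'n \<Rightarrow> real) \<Rightarrow> real ^ 'n \<Rightarrow> nat \<Rightarrow> (nat \<Rightarrow> real ^ 'n) \<Rightarrow> bool"
  where "flat_basin L \<theta>s K \<theta> \<longleftrightarrow>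
    gradient L \<theta>s = 0 \<and>
    (\<exists>B. convex B \<and> \<theta>s \<in> interior B \<and> twice_differentiable_on L B \<and>
      (\<forall>i\<in>{1..K}. \<theta> i \<in> B) \<and> checkpoint_mean K \<theta> \<in> B \<and>
      (\<exists>lmax>0. \<forall>x\<in>B.
        psd_le 0 (hessian_within L B x) \<and> psd_le (hessian_within L B x) (lmax *\<^sub>R mat 1)) \<and>
      (\<exists>\<rho>>0. \<forall>x\<in>B. \<bar>L x - quadratic_model L \<theta>s x\<bar> \<le> \<rho> / 6 * norm (x - \<theta>s) ^ 3))"

end

theory Submission
  imports Defs
begin

text \<open>
  The Hessian at an interior point of the basin does not depend on whether derivatives are taken
  within the basin, so \<open>H\<close> is positive semidefinite. Everything else follows from the variance
  identity for the quadratic form \<open>q x = x \<bullet> H x\<close>, together with the fact that \<open>q x = 0\<close> forces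
  \<open>H x = 0\<close>.
\<close>

text \<open>\<open>frechet_derivative\<close> chooses some map satisfying
  \<open>has_derivative\<close>. Functions that agree near \<open>x\<close> satisfy this predicate
  for the same maps, so the choice is the same one, even where no derivative exists.\<close>

lemma frechet_derivative_cong_eventually:
  assumes "\<forall>\<^sub>F y in nhds x. f y = g y"
  shows "frechet_derivative f (at x) = frechet_derivative g (at x)"
proof -
  have at_x: "\<forall>\<^sub>F y in at x. f y = g y"
    unfolding eventually_at_filter using assms by (rule eventually_mono) simp
  then have at_x': "\<forall>\<^sub>F y in at x. g y = f y"
    by (simp only: eq_commute)
  have x: "f x = g x"
    using assms by (rule eventually_nhds_x_imp_x)
  have "(f has_derivative D) (at x) \<longleftrightarrow> (g has_derivative D) (at x)" for D
    using has_derivative_transform_eventually[OF _ at_x x UNIV_I]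
      has_derivative_transform_eventually[OF _ at_x' x[symmetric] UNIV_I]
    by (rule iffI)
  then show ?thesis
    by (simp add: frechet_derivative_def)
qed

lemma gradient_within_interior:
  assumes "x \<in> interior S"
  shows "gradient_within f S x = gradient f x"
  by (simp add: gradient_within_def at_within_interior[OF assms])

text \<open>Pointwise agreement of the gradients at \<open>x\<close> would not suffice to
  differentiate them once more. They agree on all of \<open>interior S\<close>, an open
  neighbourhood of \<open>x\<close>, so their derivatives at \<open>x\<close> coincide too.\<close>

lemma hessian_within_interior:
  assumes "x \<in> interior S"
  shows "hessian_within f S x = hessian f x"
proof -
  have "\<forall>\<^sub>F y in nhds x. gradient_within f S y = gradient f y"
    using eventually_nhds_in_open[OF open_interior assms]
    by (rule eventually_mono) (rule gradient_within_interior)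
  then have "frechet_derivative (gradient_within f S) (at x) = frechet_derivative (gradient f) (at x)"
    by (rule frechet_derivative_cong_eventually)
  then show ?thesis
    by (simp add: hessian_within_def jacobian_def at_within_interior[OF assms])
qed

lemma symmetric_matrix_inner:
  assumes "symmetric_matrix A"
  shows "x \<bullet> (A *v y) = (A *v x) \<bullet> y"
  using assms
  by (metis dot_lmul_matrix symmetric_matrix_def transpose_matrix_vector)

lemma psd_le_0_iff:
  fixes A :: "real ^ 'n ^ 'n"
  shows "psd_le 0 A \<longleftrightarrow> symmetric_matrix A \<and> (\<forall>x. 0 \<le> x \<bullet> (A *v x))"
proof -
  have "symmetric_matrix (0 :: real ^ 'n ^ 'n)"
    by (simp add: symmetric_matrix_def transpose_def vec_eq_iff)
  then show ?thesis
    by (simp add: psd_le_def)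
qed

text \<open>If the form vanishes at \<open>x\<close>, then \<open>x\<close> minimises it. Moving
  from \<open>x\<close> along \<open>A *v x\<close> with a negative coefficient changes it to first
  order, which would make it negative unless \<open>A *v x = 0\<close>.\<close>

lemma psd_inner_eq_0_iff:
  assumes "psd_le 0 A"
  shows "x \<bullet> (A *v x) = 0 \<longleftrightarrow> A *v x = 0"
proof
  assume x: "x \<bullet> (A *v x) = 0"
  have sym: "symmetric_matrix A" and nonneg: "\<And>y. 0 \<le> y \<bullet> (A *v y)"
    using assms by (auto simp: psd_le_0_iff)
  define y where "y = A *v x"
  define b where "b = y \<bullet> (A *v y)"
  \<comment> \<open>The exact minimiser over \<open>t\<close> would have denominator
    \<open>b\<close>; \<open>b + 1\<close> stays positive when \<open>b = 0\<close> and still gives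
    a negative value if \<open>y\<close> is non-zero.\<close>
  define t where "t = - (y \<bullet> y) / (b + 1)"
  have b: "b \<ge> 0"
    using nonneg by (simp add: b_def)
  have "0 \<le> (x + t *\<^sub>R y) \<bullet> (A *v (x + t *\<^sub>R y))"
    by (rule nonneg)
  \<comment> \<open>The term \<open>x \<bullet> (A *v x)\<close> vanishes, and by symmetry each of
    the two cross terms is \<open>t * (y \<bullet> y)\<close>.\<close>
  also have "\<dots> = 2 * t * (y \<bullet> y) + t\<^sup>2 * b"
    using x symmetric_matrix_inner[OF sym, of x y]
    by (simp add: y_def[symmetric] b_def power2_eq_square inner_commute algebra_simps)
  also have "\<dots> = - (y \<bullet> y)\<^sup>2 * (b + 2) / (b + 1)\<^sup>2"
    using b by (simp add: t_def power2_eq_square divide_simps) (simp add: algebra_simps)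
  finally have "(y \<bullet> y)\<^sup>2 * (b + 2) / (b + 1)\<^sup>2 \<le> 0"
    by simp
  then have "y \<bullet> y = 0"
    using b by (auto simp: divide_le_0_iff mult_le_0_iff)
  then show "A *v x = 0"
    by (simp add: y_def)
qed simp

lemma orthogonal_projection_eq_0:
  assumes "0 \<in> S" and "\<And>w. w \<in> S \<Longrightarrow> orthogonal v w"
  shows "orthogonal_projection S v = 0"
  unfolding orthogonal_projection_def
proof (rule the_equality)
  show "0 \<in> S \<and> (\<forall>w\<in>S. orthogonal (v - 0) w)"
    using assms by simp
next
  fix p
  assume p: "p \<in> S \<and> (\<forall>w\<in>S. orthogonal (v - p) w)"
  \<comment> \<open>Both orthogonality conditions are tested on \<open>p\<close> itself; their
    difference is \<open>p \<bullet> p = 0\<close>.\<close>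
  then have "(v - p) \<bullet> p = 0" "v \<bullet> p = 0"
    using assms by (auto simp: orthogonal_def)
  then show "p = 0"
    by (simp add: inner_diff_left)
qed

text \<open>For symmetric \<open>A\<close> the kernel is orthogonal to the range, since
  \<open>v \<bullet> (A *v u) = (A *v v) \<bullet> u = 0\<close>.\<close>

lemma orthogonal_projection_range_kernel:
  assumes "symmetric_matrix A" and "v \<in> matrix_kernel A"
  shows "orthogonal_projection (matrix_range A) v = 0"
proof (rule orthogonal_projection_eq_0)
  show "0 \<in> matrix_range A"
    unfolding matrix_range_def by (rule image_eqI[of _ _ 0]) simp_all
  show "orthogonal v w" if "w \<in> matrix_range A" for w
    using that assms
    by (auto simp: matrix_range_def matrix_kernel_def orthogonal_def symmetric_matrix_inner)
qed

text \<open>Symmetry merges the two cross terms of each pair. Summed over all pairs, each square is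
  counted \<open>card I\<close> times in either index, and the cross terms assemble into the form at
  the total sum.\<close>

lemma sum_pairwise_quadratic_form:
  fixes d :: "'a \<Rightarrow> real ^ 'n"
  assumes "symmetric_matrix A"
  shows "(\<Sum>i\<in>I. \<Sum>j\<in>I. (d i - d j) \<bullet> (A *v (d i - d j))) =
    2 * real (card I) * (\<Sum>i\<in>I. d i \<bullet> (A *v d i)) -
    2 * ((\<Sum>i\<in>I. d i) \<bullet> (A *v (\<Sum>i\<in>I. d i)))"
proof -
  have "(d i - d j) \<bullet> (A *v (d i - d j)) =
      d i \<bullet> (A *v d i) + d j \<bullet> (A *v d j) - 2 * (d i \<bullet> (A *v d j))" for i j
    using symmetric_matrix_inner[OF assms, of "d i" "d j"]
    by (simp add: matrix_vector_mult_diff_distrib inner_diff inner_commute)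
  moreover have "(\<Sum>i\<in>I. d i) \<bullet> (A *v (\<Sum>i\<in>I. d i)) = (\<Sum>i\<in>I. \<Sum>j\<in>I. d i \<bullet> (A *v d j))"
    unfolding linear_sum[OF matrix_vector_mul_linear] inner_sum_left inner_sum_right
    by (rule sum.swap)
  ultimately show ?thesis
    by (simp add: sum.distrib sum_subtractf sum_distrib_left[symmetric])
qed

text \<open>In terms of displacements from \<open>\<theta>s\<close> the constant
  \<open>L \<theta>s\<close> cancels and the gap is \<open>Q / (2 * K) - M / (2 * K^2)\<close>. The
  pairwise sum is \<open>2 * K * Q - 2 * M\<close>, whence the factor
  \<open>1 / (4 * K^2)\<close>.\<close>

lemma mean_quadratic_model_gap:
  assumes "K > 0" and "symmetric_matrix (hessian L \<theta>s)"
  shows "1 / real K * (\<Sum>i=1..K. quadratic_model L \<theta>s (\<theta> i)) -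
      quadratic_model L \<theta>s (checkpoint_mean K \<theta>) =
    1 / (4 * (real K)\<^sup>2) * (\<Sum>i=1..K. \<Sum>j=1..K.
      (\<theta> i - \<theta> j) \<bullet> (hessian L \<theta>s *v (\<theta> i - \<theta> j)))"
proof -
  define A where "A = hessian L \<theta>s"
  define d where "d i = \<theta> i - \<theta>s" for i
  define Q where "Q = (\<Sum>i=1..K. d i \<bullet> (A *v d i))"
  define M where "M = (\<Sum>i=1..K. d i) \<bullet> (A *v (\<Sum>i=1..K. d i))"
  have "(\<Sum>i=1..K. d i) = (\<Sum>i=1..K. \<theta> i) - real K *\<^sub>R \<theta>s"
    by (simp add: d_def sum_subtractf sum_constant_scaleR del: sum_constant)
  then have "checkpoint_mean K \<theta> - \<theta>s = (1 / real K) *\<^sub>R (\<Sum>i=1..K. d i)"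
    using assms(1) by (simp add: checkpoint_mean_def scaleR_diff_right)
  then have model_mean: "quadratic_model L \<theta>s (checkpoint_mean K \<theta>) = L \<theta>s + M / (2 * (real K)\<^sup>2)"
    by (simp add: quadratic_model_def A_def[symmetric] M_def matrix_vector_mult_scaleR
        power2_eq_square)
  have mean_model: "1 / real K * (\<Sum>i=1..K. quadratic_model L \<theta>s (\<theta> i)) = L \<theta>s + Q / (2 * real K)"
    using assms(1)
    by (simp add: quadratic_model_def A_def[symmetric] Q_def d_def sum.distrib
        sum_divide_distrib[symmetric] field_simps)
  have pairs: "(\<Sum>i=1..K. \<Sum>j=1..K. (\<theta> i - \<theta> j) \<bullet> (A *v (\<theta> i - \<theta> j))) = 2 * real K * Q - 2 * M"
    using sum_pairwise_quadratic_form[of A d "{1..K}"] assms(2)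
    by (simp add: A_def Q_def M_def d_def)
  show ?thesis
    using assms(1) unfolding A_def[symmetric] model_mean mean_model pairs
    by (simp add: field_simps power2_eq_square)
qed

theorem theoremF1:
  fixes L :: "real ^ 'n \<Rightarrow> real"
    and \<theta>s :: "real ^ 'n"
    and \<theta> :: "nat \<Rightarrow> real ^ 'n"
    and K :: nat
    and H :: "real ^ 'n ^ 'n"
    and \<delta> :: "nat \<Rightarrow> real ^ 'n"
    and \<theta>bar :: "real ^ 'n"
    and LQ :: "real ^ 'n \<Rightarrow> real"
  assumes K: "K \<ge> 2"
    and basin: "flat_basin L \<theta>s K \<theta>"
    and H: "H = hessian L \<theta>s"
    and delta: "\<And>i. \<delta> i = \<theta> i - \<theta>s"
    and mean: "\<theta>bar = checkpoint_mean K \<theta>"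
    and LQ: "LQ = quadratic_model L \<theta>s"
  shows "psd_le 0 H \<and>
    LQ \<theta>bar \<le> 1 / real K * (\<Sum>i=1..K. LQ (\<theta> i)) \<and>
    (LQ \<theta>bar = 1 / real K * (\<Sum>i=1..K. LQ (\<theta> i)) \<longleftrightarrow>
      (\<forall>i\<in>{1..K}. \<forall>j\<in>{1..K}. \<delta> i - \<delta> j \<in> matrix_kernel H)) \<and>
    (positive_definite H \<longrightarrow>
      (LQ \<theta>bar = 1 / real K * (\<Sum>i=1..K. LQ (\<theta> i)) \<longleftrightarrow>
        (\<forall>i\<in>{1..K}. \<forall>j\<in>{1..K}. \<theta> i = \<theta> j))) \<and>
    ((\<exists>i\<in>{1..K}. \<exists>j\<in>{1..K}. orthogonal_projection (matrix_range H) (\<delta> i - \<delta> j) \<noteq> 0) \<longrightarrow>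
      LQ \<theta>bar < 1 / real K * (\<Sum>i=1..K. LQ (\<theta> i))) \<and>
    1 / real K * (\<Sum>i=1..K. LQ (\<theta> i)) - LQ \<theta>bar =
      1 / (4 * (real K)\<^sup>2) * (\<Sum>i=1..K. \<Sum>j=1..K. (\<delta> i - \<delta> j) \<bullet> (H *v (\<delta> i - \<delta> j))) \<and>
    1 / (4 * (real K)\<^sup>2) * (\<Sum>i=1..K. \<Sum>j=1..K. (\<delta> i - \<delta> j) \<bullet> (H *v (\<delta> i - \<delta> j))) \<ge> 0"
proof -
  have "\<exists>B. \<theta>s \<in> interior B \<and> (\<forall>x\<in>B. psd_le 0 (hessian_within L B x))"
    using basin unfolding flat_basin_def by (elim exE conjE) (intro exI conjI, assumption, simp)
  then obtain B where B: "\<theta>s \<in> interior B" and psd_B: "\<And>x. x \<in> B \<Longrightarrow> psd_le 0 (hessian_within L B x)"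
    by (elim exE conjE) (rule that, auto)
  \<comment> \<open>The lower Hessian bound is evaluated at \<open>\<theta>s\<close>, an interior
    point, where the Hessian within \<open>B\<close> is \<open>H\<close>.\<close>
  have psd: "psd_le 0 H"
    using psd_B[of \<theta>s] B interior_subset[of B] by (auto simp: H hessian_within_interior[OF B])
  then have sym: "symmetric_matrix H" and nonneg: "\<And>x. 0 \<le> x \<bullet> (H *v x)"
    by (auto simp: psd_le_0_iff)
  define S where "S = (\<Sum>i=1..K. \<Sum>j=1..K. (\<delta> i - \<delta> j) \<bullet> (H *v (\<delta> i - \<delta> j)))"
  have gap: "1 / real K * (\<Sum>i=1..K. LQ (\<theta> i)) - LQ \<theta>bar = 1 / (4 * (real K)\<^sup>2) * S"
    using mean_quadratic_model_gap[of K L \<theta>s \<theta>] K sym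
    by (simp add: S_def H LQ mean delta)
  have S_nonneg: "S \<ge> 0"
    unfolding S_def by (intro sum_nonneg nonneg)
  have gap_nonneg: "1 / (4 * (real K)\<^sup>2) * S \<ge> 0"
    using S_nonneg by simp
  \<comment> \<open>A sum of non-negative terms vanishes exactly when every term does, and a term
    vanishes exactly when its difference vector lies in the kernel.\<close>
  have "S = 0 \<longleftrightarrow> (\<forall>i\<in>{1..K}. \<forall>j\<in>{1..K}. \<delta> i - \<delta> j \<in> matrix_kernel H)"
    by (simp add: S_def sum_nonneg_eq_0_iff sum_nonneg nonneg psd_inner_eq_0_iff[OF psd]
        matrix_kernel_def)
  moreover have "LQ \<theta>bar = 1 / real K * (\<Sum>i=1..K. LQ (\<theta> i)) \<longleftrightarrow> 1 / (4 * (real K)\<^sup>2) * S = 0"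
    using gap by linarith
  \<comment> \<open>Since \<open>K \<ge> 2\<close>, the factor \<open>1 / (4 * K^2)\<close> is
    non-zero, so the gap vanishes exactly when \<open>S\<close> does.\<close>
  ultimately have eq_iff: "LQ \<theta>bar = 1 / real K * (\<Sum>i=1..K. LQ (\<theta> i)) \<longleftrightarrow>
      (\<forall>i\<in>{1..K}. \<forall>j\<in>{1..K}. \<delta> i - \<delta> j \<in> matrix_kernel H)"
    using K by simp
  have le: "LQ \<theta>bar \<le> 1 / real K * (\<Sum>i=1..K. LQ (\<theta> i))"
    using gap gap_nonneg by linarith
  have kernel_pd: "v \<in> matrix_kernel H \<longleftrightarrow> v = 0" if "positive_definite H" for v
    using that by (force simp: positive_definite_def matrix_kernel_def)
  have pd: "positive_definite H \<longrightarrow>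
      (LQ \<theta>bar = 1 / real K * (\<Sum>i=1..K. LQ (\<theta> i)) \<longleftrightarrow>
        (\<forall>i\<in>{1..K}. \<forall>j\<in>{1..K}. \<theta> i = \<theta> j))"
    unfolding eq_iff by (simp add: kernel_pd delta)
  \<comment> \<open>Equality would put every difference into the kernel, where the projection onto
    the range is zero.\<close>
  have strict: "(\<exists>i\<in>{1..K}. \<exists>j\<in>{1..K}. orthogonal_projection (matrix_range H) (\<delta> i - \<delta> j) \<noteq> 0) \<longrightarrow>
      LQ \<theta>bar < 1 / real K * (\<Sum>i=1..K. LQ (\<theta> i))"
    using le eq_iff orthogonal_projection_range_kernel[OF sym] by (meson order_le_less)
  show ?thesis
    using psd le eq_iff pd strict gap gap_nonneg unfolding S_def by blast
qed

end
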